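(* Let $U=U_1\times\cdots\times U_m$ with $U_i=\{0,1,\dots,|U_i|-1\}$ finite and nonempty. For any set $S\subseteq U$, any one-dimensional minor-subproduct $M$ of $U$, and any $i$, $f_i(S)\le f_i(S[M\downarrow])$. If $S$ is ample, then (1) $f_i(S)=f_i(S[M\downarrow])$ for any $i$, thus $f(S[M\downarrow])=f(S)$; and (2) if $S_*$ is the stable ample set obtained by any complete serial push down $S[1,\dots,m\downarrow]$ of $S$, then $S_*$ is a bouquet of prisms with origin $\mathbf 0=(0,\dots,0)$.
   Context: A box of $U$ is a set $B=B_1\times\cdots\times B_m$ with $\varnothing\ne B_i\subseteq U_i$; its dimension is $\sum_i(|B_i|-1)$. $f_i(S)$ is the number of boxes of dimension $i$ contained in $S$ and $f(S)=(f_0(S),f_1(S),\dots)$. A set $T\subseteq U$ is a bouquet of prisms with origin $v_0$ if $v_0\in T$ and $v_0$ belongs to every inclusion-maximal box contained in $T$. A generalized partition of $U$ is a tuple $\Lambda=(\alpha_1,\dots,\alpha_m)$ with $\alpha_i$ a partition of $U_i$ into nonempty blocks; it defines a partition of $U$ into the boxes $P^1\times\cdots\times P^m$, $P^i\in\alpha_i$, and the minor-subproduct $M(\Lambda)=M_1\times\cdots\times M_m$, where $M_i$ is the set of blocks of $\alpha_i$. $M(\Lambda)$ is shattered by $S\subseteq U$ if $S$ meets every box of the box-partition. A copy of $M(\Lambda)$ is a set $W_1\times\cdots\times W_m$ where $W_i$ consists of exactly one element from each block of $\alpha_i$. $M(\Lambda)$ is strongly shattered by $S$ if $S$ contains a copy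 of it. $S$ is ample if every minor-subproduct of $U$ shattered by $S$ is strongly shattered by $S$. $M(\Lambda)$ is one-dimensional if exactly one $\alpha_i$ has a non-singleton block; then each box $B$ of its box-partition consists of tuples differing only in coordinate $i$, and the push down $S[M\downarrow]$ is the set such that, for each such box $B$, $S[M\downarrow]\cap B$ consists of the $|S\cap B|$ elements of $B$ with the smallest $i$-th coordinates. A set is stable if $S[M\downarrow]=S$ for every one-dimensional $M$. Write $S[i\downarrow]$ for the push down with respect to the minor-subproduct with $\alpha_i=\{U_i\}$ and all other partitions consisting of singletons (the identity if $|U_i|=1$). A complete serial push down of $S$ is $S[1,\dots,m\downarrow]=S[1\downarrow][2\downarrow]\cdots[m\downarrow]$ for any enumeration $1,\dots,m$ of the coordinates; for ample $S$ the result is independent of the enumeration and is a stable ample set.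
   Formalization: In (2) the set S is assumed nonempty: the empty set is vacuously ample, and its complete serial push down is empty, so it does not contain the origin and is not a bouquet of prisms. *)

theory Defs
  imports "HOL-Library.FuncSet" "HOL-Library.Disjoint_Sets"
begin

text \<open>
  The ambient product \<open>U\<close> has \<open>m\<close> factors, the \<open>i\<close>-th one being \<open>{0, \<dots>, n i - 1}\<close> for \<open>i < m\<close>
  (coordinates are numbered from 0). Tuples are extensional functions on \<open>{..<m}\<close>.
\<close>

definition grid :: "nat \<Rightarrow> (nat \<Rightarrow> nat) \<Rightarrow> (nat \<Rightarrow> nat) set" where
  "grid m n = (\<Pi>\<^sub>E i\<in>{..<m}. {..<n i})"

definition is_box :: "nat \<Rightarrow> (nat \<Rightarrow> nat) \<Rightarrow> (nat \<Rightarrow> nat) set \<Rightarrow> bool" where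
  "is_box m n B \<longleftrightarrow>
     (\<exists>C. (\<forall>i<m. C i \<noteq> {} \<and> C i \<subseteq> {..<n i}) \<and> B = (\<Pi>\<^sub>E i\<in>{..<m}. C i))"

text \<open>The factors of a (nonempty) box are its projections; see \<open>box_dim_PiE\<close> below.\<close>

definition box_dim :: "nat \<Rightarrow> (nat \<Rightarrow> nat) set \<Rightarrow> nat" where
  "box_dim m B = (\<Sum>i<m. card ((\<lambda>x. x i) ` B) - 1)"

lemma box_dim_PiE:
  assumes "\<forall>i<m. C i \<noteq> {}"
  shows "box_dim m (\<Pi>\<^sub>E i\<in>{..<m}. C i) = (\<Sum>i<m. card (C i) - 1)"
proof -
  have "(\<Pi>\<^sub>E i\<in>{..<m}. C i) \<noteq> {}"
    using assms by (simp add: PiE_eq_empty_iff)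
  then have "(\<lambda>x. x i) ` (\<Pi>\<^sub>E i\<in>{..<m}. C i) = C i" if "i < m" for i
    using that by (simp add: image_projection_PiE)
  then show ?thesis
    by (simp add: box_dim_def)
qed

definition f_vector :: "nat \<Rightarrow> (nat \<Rightarrow> nat) \<Rightarrow> (nat \<Rightarrow> nat) set \<Rightarrow> nat \<Rightarrow> nat" where
  "f_vector m n S = (\<lambda>d. card {B. is_box m n B \<and> B \<subseteq> S \<and> box_dim m B = d})"

definition maximal_box :: "nat \<Rightarrow> (nat \<Rightarrow> nat) \<Rightarrow> (nat \<Rightarrow> nat) set \<Rightarrow> (nat \<Rightarrow> nat) set \<Rightarrow> bool" where
  "maximal_box m n T B \<longleftrightarrow>
     is_box m n B \<and> B \<subseteq> T \<and> (\<forall>B'. is_box m n B' \<and> B' \<subseteq> T \<and> B \<subseteq> B' \<longrightarrow> B' = B)"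

definition bouquet_of_prisms ::
    "nat \<Rightarrow> (nat \<Rightarrow> nat) \<Rightarrow> (nat \<Rightarrow> nat) \<Rightarrow> (nat \<Rightarrow> nat) set \<Rightarrow> bool" where
  "bouquet_of_prisms m n v T \<longleftrightarrow>
     T \<subseteq> grid m n \<and> v \<in> T \<and> (\<forall>B. maximal_box m n T B \<longrightarrow> v \<in> B)"

definition origin :: "nat \<Rightarrow> nat \<Rightarrow> nat" where
  "origin m = (\<lambda>i\<in>{..<m}. 0)"

definition generalized_partition :: "nat \<Rightarrow> (nat \<Rightarrow> nat) \<Rightarrow> (nat \<Rightarrow> nat set set) \<Rightarrow> bool" where
  "generalized_partition m n \<alpha> \<longleftrightarrow> (\<forall>i<m. partition_on {..<n i} (\<alpha> i))"

text \<open>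
  The elements of the minor-subproduct are tuples \<open>P\<close> of blocks; the boxes of the partition of
  \<open>U\<close> are the products of the entries of these tuples.
\<close>

definition minor_subproduct :: "nat \<Rightarrow> (nat \<Rightarrow> nat set set) \<Rightarrow> (nat \<Rightarrow> nat set) set" where
  "minor_subproduct m \<alpha> = (\<Pi>\<^sub>E i\<in>{..<m}. \<alpha> i)"

definition box_partition :: "nat \<Rightarrow> (nat \<Rightarrow> nat set set) \<Rightarrow> (nat \<Rightarrow> nat) set set" where
  "box_partition m \<alpha> = (\<lambda>P. \<Pi>\<^sub>E i\<in>{..<m}. P i) ` minor_subproduct m \<alpha>"

definition shattered :: "nat \<Rightarrow> (nat \<Rightarrow> nat set set) \<Rightarrow> (nat \<Rightarrow> nat) set \<Rightarrow> bool" where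
  "shattered m \<alpha> S \<longleftrightarrow> (\<forall>B\<in>box_partition m \<alpha>. S \<inter> B \<noteq> {})"

definition is_copy :: "nat \<Rightarrow> (nat \<Rightarrow> nat set set) \<Rightarrow> (nat \<Rightarrow> nat) set \<Rightarrow> bool" where
  "is_copy m \<alpha> C \<longleftrightarrow>
     (\<exists>W. (\<forall>i<m. W i \<subseteq> \<Union>(\<alpha> i) \<and> (\<forall>P\<in>\<alpha> i. \<exists>!x. x \<in> W i \<inter> P)) \<and>
          C = (\<Pi>\<^sub>E i\<in>{..<m}. W i))"

definition strongly_shattered :: "nat \<Rightarrow> (nat \<Rightarrow> nat set set) \<Rightarrow> (nat \<Rightarrow> nat) set \<Rightarrow> bool" where
  "strongly_shattered m \<alpha> S \<longleftrightarrow> (\<exists>C. is_copy m \<alpha> C \<and> C \<subseteq> S)"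

definition ample :: "nat \<Rightarrow> (nat \<Rightarrow> nat) \<Rightarrow> (nat \<Rightarrow> nat) set \<Rightarrow> bool" where
  "ample m n S \<longleftrightarrow>
     (\<forall>\<alpha>. generalized_partition m n \<alpha> \<and> shattered m \<alpha> S \<longrightarrow> strongly_shattered m \<alpha> S)"

text \<open>
  \<open>one_dimensional m n \<alpha> j\<close>: the minor-subproduct of \<open>\<alpha>\<close> is one-dimensional, and \<open>j\<close> is the
  (uniquely determined) coordinate whose partition has a non-singleton block.
\<close>

definition one_dimensional ::
    "nat \<Rightarrow> (nat \<Rightarrow> nat) \<Rightarrow> (nat \<Rightarrow> nat set set) \<Rightarrow> nat \<Rightarrow> bool" where
  "one_dimensional m n \<alpha> j \<longleftrightarrow>
     generalized_partition m n \<alpha> \<and> j < m \<and> (\<exists>P\<in>\<alpha> j. \<not> is_singleton P) \<and>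
     (\<forall>i<m. i \<noteq> j \<longrightarrow> (\<forall>P\<in>\<alpha> i. is_singleton P))"

text \<open>
  If the elements of \<open>B\<close> have pairwise distinct \<open>j\<close>-th coordinates and \<open>k \<le> card B\<close>, then
  \<open>lowest j k B\<close> consists of the \<open>k\<close> elements of \<open>B\<close> with the smallest \<open>j\<close>-th coordinates.
\<close>

definition lowest :: "nat \<Rightarrow> nat \<Rightarrow> (nat \<Rightarrow> nat) set \<Rightarrow> (nat \<Rightarrow> nat) set" where
  "lowest j k B = {x \<in> B. card {y \<in> B. y j < x j} < k}"

definition push_down ::
    "nat \<Rightarrow> (nat \<Rightarrow> nat set set) \<Rightarrow> nat \<Rightarrow> (nat \<Rightarrow> nat) set \<Rightarrow> (nat \<Rightarrow> nat) set" where
  "push_down m \<alpha> j S = (\<Union>B\<in>box_partition m \<alpha>. lowest j (card (S \<inter> B)) B)"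

definition coord_partition :: "(nat \<Rightarrow> nat) \<Rightarrow> nat \<Rightarrow> nat \<Rightarrow> nat set set" where
  "coord_partition n j = (\<lambda>i. if i = j then {{..<n i}} else (\<lambda>x. {x}) ` {..<n i})"

definition push_down_coord ::
    "nat \<Rightarrow> (nat \<Rightarrow> nat) \<Rightarrow> nat \<Rightarrow> (nat \<Rightarrow> nat) set \<Rightarrow> (nat \<Rightarrow> nat) set" where
  "push_down_coord m n j S = (if n j = 1 then S else push_down m (coord_partition n j) j S)"

text \<open>The list \<open>js\<close> gives the order of the coordinates: its head is pushed down first.\<close>

definition serial_push_down ::
    "nat \<Rightarrow> (nat \<Rightarrow> nat) \<Rightarrow> nat list \<Rightarrow> (nat \<Rightarrow> nat) set \<Rightarrow> (nat \<Rightarrow> nat) set" where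
  "serial_push_down m n js S = fold (push_down_coord m n) js S"

end

theory Submission
  imports Defs
begin

text \<open>
  Write \<open>A\<^sub>S(C)\<close> for the set of those \<open>p\<close> for which \<open>S\<close> contains the box with \<open>j\<close>-th factor \<open>{p}\<close>
  and remaining factors \<open>C\<close>. The number of boxes in \<open>S\<close> of a given dimension with remaining factors
  \<open>C\<close> is a binomial coefficient that increases with \<open>card A\<^sub>S(C)\<close>. For each block \<open>P\<close> of the
  partition of the \<open>j\<close>-th factor, the push down turns \<open>A\<^sub>S(C) \<inter> P\<close> into an initial segment of \<open>P\<close>
  whose size is the minimum, over the points of the box \<open>C\<close>, of the number of points of \<open>S\<close> in the
  fibre over \<open>P\<close>. This minimum is at least \<open>card (A\<^sub>S(C) \<inter> P)\<close>.

  If \<open>S\<close> is ample, then so is its trace on every box, and equality holds: a positive minimum means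
  that the box with factors \<open>C\<close> and \<open>P\<close> shatters the partition with the single block \<open>P\<close> in
  coordinate \<open>j\<close>, so \<open>A\<^sub>S(C) \<inter> P\<close> contains a point, which can be removed from \<open>P\<close>.

  A complete serial push down is a down-set, and factors of boxes in a down-set may be
  enlarged by \<open>0\<close>.
\<close>

subsection \<open>Ampleness on sub-boxes\<close>

text \<open>Ampleness relative to an arbitrary product of sets: deleting a point from a factor need
  not leave an initial segment of the naturals. Only the points of \<open>S\<close> inside the
  product matter, so this is ampleness of a trace.\<close>

definition ample_on :: "nat \<Rightarrow> (nat \<Rightarrow> nat set) \<Rightarrow> (nat \<Rightarrow> nat) set \<Rightarrow> bool" where
  "ample_on m U S \<longleftrightarrow>
     (\<forall>\<alpha>. (\<forall>i<m. partition_on (U i) (\<alpha> i)) \<and> shattered m \<alpha> S \<longrightarrow> strongly_shattered m \<alpha> S)"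

lemma ample_eq_ample_on: "ample m n S \<longleftrightarrow> ample_on m (\<lambda>i. {..<n i}) S"
  by (simp add: ample_def ample_on_def generalized_partition_def)

lemma ample_on_cong: "(\<And>i. i < m \<Longrightarrow> U i = V i) \<Longrightarrow> ample_on m U S \<longleftrightarrow> ample_on m V S"
  by (simp add: ample_on_def)

text \<open>Frees the index tuple from extensionality, so that \<open>Q\<close> can be any function,
  for instance one defined by cases.\<close>

lemma mem_box_partition_iff:
  "B \<in> box_partition m \<alpha> \<longleftrightarrow> (\<exists>Q. (\<forall>i<m. Q i \<in> \<alpha> i) \<and> B = (\<Pi>\<^sub>E i\<in>{..<m}. Q i))"
proof
  assume "B \<in> box_partition m \<alpha>"
  then show "\<exists>Q. (\<forall>i<m. Q i \<in> \<alpha> i) \<and> B = (\<Pi>\<^sub>E i\<in>{..<m}. Q i)"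
    unfolding box_partition_def minor_subproduct_def by blast
next
  assume "\<exists>Q. (\<forall>i<m. Q i \<in> \<alpha> i) \<and> B = (\<Pi>\<^sub>E i\<in>{..<m}. Q i)"
  then obtain Q where Q: "\<forall>i<m. Q i \<in> \<alpha> i" and B: "B = (\<Pi>\<^sub>E i\<in>{..<m}. Q i)"
    by (elim exE conjE)
  have "B = (\<Pi>\<^sub>E i\<in>{..<m}. restrict Q {..<m} i)"
    unfolding B by (rule PiE_cong) simp
  moreover have "restrict Q {..<m} \<in> minor_subproduct m \<alpha>"
    using Q by (simp add: minor_subproduct_def PiE_iff)
  ultimately show "B \<in> box_partition m \<alpha>"
    unfolding box_partition_def by (rule image_eqI)
qed

lemma shattered_iff:
  "shattered m \<alpha> S \<longleftrightarrow> (\<forall>Q. (\<forall>i<m. Q i \<in> \<alpha> i) \<longrightarrow> S \<inter> (\<Pi>\<^sub>E i\<in>{..<m}. Q i) \<noteq> {})"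
  unfolding shattered_def Ball_def mem_box_partition_iff by metis

lemma strongly_shatteredE:
  assumes "strongly_shattered m \<alpha> S"
  obtains W where "\<And>i. i < m \<Longrightarrow> W i \<subseteq> \<Union>(\<alpha> i)"
    and "\<And>i P. i < m \<Longrightarrow> P \<in> \<alpha> i \<Longrightarrow> \<exists>!x. x \<in> W i \<inter> P"
    and "(\<Pi>\<^sub>E i\<in>{..<m}. W i) \<subseteq> S"
  using assms unfolding strongly_shattered_def is_copy_def
proof (elim exE conjE)
  fix C W
  assume "\<forall>i<m. W i \<subseteq> \<Union>(\<alpha> i) \<and> (\<forall>P\<in>\<alpha> i. \<exists>!x. x \<in> W i \<inter> P)"
    and "C = (\<Pi>\<^sub>E i\<in>{..<m}. W i)" and "C \<subseteq> S"
  then show thesis using that[of W] by simp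
qed

lemma strongly_shatteredI:
  assumes "\<And>i. i < m \<Longrightarrow> W i \<subseteq> \<Union>(\<alpha> i)"
    and "\<And>i P. i < m \<Longrightarrow> P \<in> \<alpha> i \<Longrightarrow> \<exists>!x. x \<in> W i \<inter> P"
    and "(\<Pi>\<^sub>E i\<in>{..<m}. W i) \<subseteq> S"
  shows "strongly_shattered m \<alpha> S"
proof -
  have "is_copy m \<alpha> (\<Pi>\<^sub>E i\<in>{..<m}. W i)"
    unfolding is_copy_def using assms(1,2) by (intro exI[of _ W]) simp
  then show ?thesis using assms(3) unfolding strongly_shattered_def by blast
qed

text \<open>
  A partition of \<open>U e - {c}\<close> extends to \<open>U e\<close> either by the new block \<open>{c}\<close> or by adding \<open>c\<close> to an
  existing block. If neither kind of extension yields a copy that avoids \<open>c\<close>, then \<open>S\<close> misses a box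
  over \<open>{c}\<close> and contains a copy through \<open>c\<close>; but these two sets meet.
\<close>

lemma ample_on_remove:
  assumes ample: "ample_on m U S" and "e < m" and "c \<in> U e" and "U e - {c} \<noteq> {}"
  shows "ample_on m (U(e := U e - {c})) S"
  unfolding ample_on_def
proof (intro allI impI, elim conjE)
  fix \<alpha>
  assume part: "\<forall>i<m. partition_on ((U(e := U e - {c})) i) (\<alpha> i)" and sh: "shattered m \<alpha> S"
  have part_e: "partition_on (U e - {c}) (\<alpha> e)"
    and part_i: "\<And>i. i < m \<Longrightarrow> i \<noteq> e \<Longrightarrow> partition_on (U i) (\<alpha> i)"
    using part \<open>e < m\<close> by (auto dest: spec[of _ e])
  have un: "\<Union>(\<alpha> e) = U e - {c}"
    using part_e by (simp add: partition_on_def)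
  obtain Q where Q: "Q \<in> \<alpha> e"
    using un \<open>U e - {c} \<noteq> {}\<close> by blast
  define \<beta> where "\<beta> = \<alpha>(e := insert {c} (\<alpha> e))"
  define \<gamma> where "\<gamma> = \<alpha>(e := insert (insert c Q) (\<alpha> e - {Q}))"
  have disj: "P \<inter> P' = {}" if "P \<in> \<alpha> e" "P' \<in> \<alpha> e" "P \<noteq> P'" for P P'
    using part_e that by (auto simp: partition_on_def disjoint_def)
  have "partition_on (U i) (\<beta> i)" if "i < m" for i
  proof (cases "i = e")
    case True
    have "partition_on (U e) (insert {c} (\<alpha> e))"
      using part_e un \<open>c \<in> U e\<close> by (auto simp: partition_on_def disjoint_def)
    then show ?thesis using True by (simp add: \<beta>_def)
  qed (use part_i that in \<open>simp add: \<beta>_def\<close>)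
  then have \<beta>: "shattered m \<beta> S \<longrightarrow> strongly_shattered m \<beta> S"
    using ample unfolding ample_on_def by blast
  have "partition_on (U i) (\<gamma> i)" if "i < m" for i
  proof (cases "i = e")
    case True
    have "partition_on (U e) (insert (insert c Q) (\<alpha> e - {Q}))"
      unfolding partition_on_def
    proof (intro conjI)
      have "\<Union>(insert (insert c Q) (\<alpha> e - {Q})) = insert c (\<Union>(\<alpha> e))"
        using Q by blast
      also have "\<dots> = U e"
        unfolding un using \<open>c \<in> U e\<close> by auto
      finally show "\<Union>(insert (insert c Q) (\<alpha> e - {Q})) = U e" .
      have "insert c Q \<inter> P = {}" if "P \<in> \<alpha> e - {Q}" for P
        using disj[of Q P] Q that un by blast
      then show "disjoint (insert (insert c Q) (\<alpha> e - {Q}))"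
        using disj unfolding disjoint_def by blast
      show "{} \<notin> insert (insert c Q) (\<alpha> e - {Q})"
        using part_e by (auto simp: partition_on_def)
    qed
    then show ?thesis using True by (simp add: \<gamma>_def)
  qed (use part_i that in \<open>simp add: \<gamma>_def\<close>)
  moreover have "shattered m \<gamma> S"
    unfolding shattered_iff
  proof (intro allI impI)
    fix R assume R: "\<forall>i<m. R i \<in> \<gamma> i"
    \<comment> \<open>Shrinking the enlarged block back to \<open>Q\<close> turns \<open>R\<close>
      into a box of \<alpha>, which \<open>S\<close> meets by assumption.\<close>
    define R' where "R' = R(e := if R e = insert c Q then Q else R e)"
    have "\<forall>i<m. R' i \<in> \<alpha> i"
      using R Q by (auto simp: R'_def \<gamma>_def split: if_splits)
    then have "S \<inter> (\<Pi>\<^sub>E i\<in>{..<m}. R' i) \<noteq> {}"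
      using sh by (simp add: shattered_iff)
    moreover have "(\<Pi>\<^sub>E i\<in>{..<m}. R' i) \<subseteq> (\<Pi>\<^sub>E i\<in>{..<m}. R i)"
      by (rule PiE_mono) (auto simp: R'_def)
    ultimately show "S \<inter> (\<Pi>\<^sub>E i\<in>{..<m}. R i) \<noteq> {}" by blast
  qed
  ultimately have "strongly_shattered m \<gamma> S"
    using ample unfolding ample_on_def by blast
  then obtain W where W: "\<And>i. i < m \<Longrightarrow> W i \<subseteq> \<Union>(\<gamma> i)"
      "\<And>i P. i < m \<Longrightarrow> P \<in> \<gamma> i \<Longrightarrow> \<exists>!x. x \<in> W i \<inter> P" "(\<Pi>\<^sub>E i\<in>{..<m}. W i) \<subseteq> S"
    by (rule strongly_shatteredE) blast
  show "strongly_shattered m \<alpha> S"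
  proof (cases "c \<in> W e")
    case False
    show ?thesis
    proof (rule strongly_shatteredI[of _ W])
      show "W i \<subseteq> \<Union>(\<alpha> i)" if "i < m" for i
      proof (cases "i = e")
        case True
        then show ?thesis using W(1)[OF that] False Q by (auto simp: \<gamma>_def)
      qed (use W(1)[OF that] in \<open>simp add: \<gamma>_def\<close>)
      show "\<exists>!x. x \<in> W i \<inter> P" if "i < m" "P \<in> \<alpha> i" for i P
      proof (cases "i = e \<and> P = Q")
        case True
        \<comment> \<open>The copy avoids \<open>c\<close>, so its point in the enlarged block
          already lies in \<open>Q\<close>.\<close>
        then have "W i \<inter> P = W i \<inter> insert c Q" using False by blast
        then show ?thesis using W(2)[OF that(1), of "insert c Q"] True by (simp add: \<gamma>_def)
      next
        case False
        then have "P \<in> \<gamma> i" using that by (auto simp: \<gamma>_def)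
        then show ?thesis using W(2) that(1) by blast
      qed
    qed (use W in blast)
  next
    case c: True
    \<comment> \<open>Boxes over \<open>{c}\<close> are met by the copy \<open>W\<close>: its factor
      at \<open>e\<close> contains \<open>c\<close>, and away from \<open>e\<close> the partitions
      \<beta> and \<gamma> agree. All other boxes of \<beta> are boxes of \<alpha>.\<close>
    have "shattered m \<beta> S"
      unfolding shattered_iff
    proof (intro allI impI)
      fix R assume R: "\<forall>i<m. R i \<in> \<beta> i"
      show "S \<inter> (\<Pi>\<^sub>E i\<in>{..<m}. R i) \<noteq> {}"
      proof (cases "R e = {c}")
        case True
        have "\<exists>x. x \<in> W i \<inter> R i" if "i < m" for i
        proof (cases "i = e")
          case False
          then have "R i \<in> \<gamma> i" using R[rule_format, OF that] by (simp add: \<beta>_def \<gamma>_def)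
          then show ?thesis using W(2)[OF that] by blast
        qed (use c True in auto)
        then obtain x where x: "\<And>i. i < m \<Longrightarrow> x i \<in> W i \<inter> R i" by metis
        then have "restrict x {..<m} \<in> (\<Pi>\<^sub>E i\<in>{..<m}. W i)"
          "restrict x {..<m} \<in> (\<Pi>\<^sub>E i\<in>{..<m}. R i)" by auto
        then show ?thesis using W(3) by blast
      next
        case False
        then have "\<forall>i<m. R i \<in> \<alpha> i" using R by (auto simp: \<beta>_def split: if_splits)
        then show ?thesis using sh by (simp add: shattered_iff)
      qed
    qed
    with \<beta> obtain V where V: "\<And>i. i < m \<Longrightarrow> V i \<subseteq> \<Union>(\<beta> i)"
      "\<And>i P. i < m \<Longrightarrow> P \<in> \<beta> i \<Longrightarrow> \<exists>!x. x \<in> V i \<inter> P" "(\<Pi>\<^sub>E i\<in>{..<m}. V i) \<subseteq> S"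
      using strongly_shatteredE by metis
    show ?thesis
    \<comment> \<open>The point chosen by \<open>V e\<close> in the block \<open>{c}\<close> is
      \<open>c\<close> itself; deleting it keeps the choices in all blocks of \<alpha>.\<close>
    proof (rule strongly_shatteredI[of _ "V(e := V e - {c})"])
      show "(V(e := V e - {c})) i \<subseteq> \<Union>(\<alpha> i)" if "i < m" for i
        using V(1)[OF that] by (auto simp: \<beta>_def split: if_splits)
      show "\<exists>!x. x \<in> (V(e := V e - {c})) i \<inter> P" if "i < m" "P \<in> \<alpha> i" for i P
      proof -
        have eq: "(V(e := V e - {c})) i \<inter> P = V i \<inter> P"
          using that un by auto
        have "P \<in> \<beta> i" using that by (auto simp: \<beta>_def)
        then show ?thesis unfolding eq by (rule V(2)[OF that(1)])
      qed
      have "(\<Pi>\<^sub>E i\<in>{..<m}. (V(e := V e - {c})) i) \<subseteq> (\<Pi>\<^sub>E i\<in>{..<m}. V i)"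
        by (rule PiE_mono) auto
      then show "(\<Pi>\<^sub>E i\<in>{..<m}. (V(e := V e - {c})) i) \<subseteq> S"
        using V(3) by (rule subset_trans)
    qed
  qed
qed

text \<open>The points of \<open>U\<close> outside \<open>C\<close> are deleted one at a time. Each
  shrunken factor still contains the nonempty set \<open>C e\<close>, so
  \<open>ample_on_remove\<close> applies at every stage.\<close>

lemma ample_on_subset:
  assumes "ample_on m U S" and "\<And>i. i < m \<Longrightarrow> finite (U i)"
    and "\<And>i. i < m \<Longrightarrow> C i \<noteq> {} \<and> C i \<subseteq> U i"
  shows "ample_on m C S"
  using assms
proof (induction "\<Sum>i<m. card (U i - C i)" arbitrary: U rule: less_induct)
  case less
  show ?case
  proof (cases "\<forall>i<m. U i = C i")
    case True
    then show ?thesis using less.prems(1) ample_on_cong by metis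
  next
    case False
    then obtain e c where e: "e < m" and c: "c \<in> U e" "c \<notin> C e"
      using less.prems(3) by blast
    define V where "V = U(e := U e - {c})"
    have "C e \<subseteq> U e - {c}" using less.prems(3)[OF e] c by blast
    then have "ample_on m V S"
      unfolding V_def using less.prems e c by (intro ample_on_remove) blast+
    moreover have "(\<Sum>i<m. card (V i - C i)) < (\<Sum>i<m. card (U i - C i))"
    proof (rule sum_strict_mono_ex1)
      show "\<forall>i\<in>{..<m}. card (V i - C i) \<le> card (U i - C i)"
        using less.prems(2) by (auto simp: V_def intro!: card_mono)
      have "card (V e - C e) < card (U e - C e)"
        using less.prems(2)[OF e] c by (intro psubset_card_mono) (auto simp: V_def)
      then show "\<exists>i\<in>{..<m}. card (V i - C i) < card (U i - C i)"
        using e by blast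
    qed simp
    moreover have "finite (V i)" "C i \<noteq> {} \<and> C i \<subseteq> V i" if "i < m" for i
      using less.prems(2,3)[OF that] c by (auto simp: V_def)
    ultimately show ?thesis using less.hyps by blast
  qed
qed

section \<open>Common points of the fibres of an ample set\<close>

text \<open>Take the single block \<open>U j\<close> in coordinate \<open>j\<close> and singletons
  elsewhere. Shattering says that every fibre in direction \<open>j\<close> meets \<open>S\<close>,
  and a copy is a full slice of the box at one value \<open>p\<close>.\<close>

lemma ample_on_common_point:
  assumes "ample_on m U S" and "j < m" and "U j \<noteq> {}"
    and "\<And>x. x \<in> (\<Pi>\<^sub>E i\<in>{..<m} - {j}. U i) \<Longrightarrow> \<exists>p\<in>U j. x(j := p) \<in> S"
  shows "\<exists>p\<in>U j. \<forall>x\<in>(\<Pi>\<^sub>E i\<in>{..<m} - {j}. U i). x(j := p) \<in> S"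
proof -
  define \<alpha> where "\<alpha> = (\<lambda>i. if i = j then {U j} else (\<lambda>x. {x}) ` U i)"
  have "\<forall>i<m. partition_on (U i) (\<alpha> i)"
    using \<open>U j \<noteq> {}\<close> by (auto simp: \<alpha>_def partition_on_singletons intro: partition_on_space)
  moreover have "shattered m \<alpha> S"
    unfolding shattered_iff
  proof (intro allI impI)
    fix R assume R: "\<forall>i<m. R i \<in> \<alpha> i"
    then have "\<exists>y. y \<in> U i \<and> R i = {y}" if "i < m" "i \<noteq> j" for i
      using R[rule_format, OF that(1)] that(2) by (auto simp: \<alpha>_def)
    then obtain y where y: "\<And>i. i < m \<Longrightarrow> i \<noteq> j \<Longrightarrow> y i \<in> U i \<and> R i = {y i}" by metis
    define x where "x = restrict y ({..<m} - {j})"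
    have "x \<in> (\<Pi>\<^sub>E i\<in>{..<m} - {j}. U i)" using y by (auto simp: x_def)
    then obtain p where "p \<in> U j" "x(j := p) \<in> S" using assms(4) by blast
    moreover from this have "x(j := p) \<in> (\<Pi>\<^sub>E i\<in>{..<m}. R i)"
      using y R \<open>j < m\<close> by (auto simp: x_def \<alpha>_def PiE_iff extensional_def)
    ultimately show "S \<inter> (\<Pi>\<^sub>E i\<in>{..<m}. R i) \<noteq> {}" by blast
  qed
  ultimately have "strongly_shattered m \<alpha> S"
    using assms(1) unfolding ample_on_def by blast
  then obtain W where W: "\<And>i P. i < m \<Longrightarrow> P \<in> \<alpha> i \<Longrightarrow> \<exists>!x. x \<in> W i \<inter> P"
      "(\<Pi>\<^sub>E i\<in>{..<m}. W i) \<subseteq> S"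
    by (rule strongly_shatteredE) blast
  obtain p where p: "p \<in> W j" "p \<in> U j"
    using W(1)[OF \<open>j < m\<close>, of "U j"] by (auto simp: \<alpha>_def)
  have "x(j := p) \<in> S" if x: "x \<in> (\<Pi>\<^sub>E i\<in>{..<m} - {j}. U i)" for x
  proof -
    have "x i \<in> W i" if "i < m" "i \<noteq> j" for i
    proof -
      have "{x i} \<in> \<alpha> i" using x that by (auto simp: \<alpha>_def)
      then show ?thesis using W(1)[OF that(1)] by blast
    qed
    then have "x(j := p) \<in> (\<Pi>\<^sub>E i\<in>{..<m}. W i)"
      using p x \<open>j < m\<close> by (auto simp: PiE_iff extensional_def)
    then show ?thesis using W(2) by blast
  qed
  then show ?thesis using p by blast
qed

text \<open>Induction on \<open>k\<close>. A common point \<open>c\<close> lies in every fibre, so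
  deleting it from \<open>U j\<close> preserves ampleness and lowers each fibre, as well as the set
  of common points, by exactly one.\<close>

lemma ample_on_card_common:
  assumes "ample_on m U S" and "j < m" and "\<And>i. i < m \<Longrightarrow> finite (U i) \<and> U i \<noteq> {}"
    and "\<And>x. x \<in> (\<Pi>\<^sub>E i\<in>{..<m} - {j}. U i) \<Longrightarrow> k \<le> card {p\<in>U j. x(j := p) \<in> S}"
  shows "k \<le> card {p\<in>U j. \<forall>x\<in>(\<Pi>\<^sub>E i\<in>{..<m} - {j}. U i). x(j := p) \<in> S}"
  using assms
proof (induction k arbitrary: U)
  case (Suc k)
  let ?A = "\<lambda>U. {p\<in>U j. \<forall>x\<in>(\<Pi>\<^sub>E i\<in>{..<m} - {j}. U i). x(j := p) \<in> S}"
  have fin: "finite (U j)" using Suc.prems by blast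
  have ex: "\<exists>p\<in>U j. x(j := p) \<in> S" if "x \<in> (\<Pi>\<^sub>E i\<in>{..<m} - {j}. U i)" for x
  proof -
    have "{p\<in>U j. x(j := p) \<in> S} \<noteq> {}"
    proof
      assume eq: "{p\<in>U j. x(j := p) \<in> S} = {}"
      show False using Suc.prems(4)[OF that] unfolding eq by simp
    qed
    then show ?thesis by blast
  qed
  have "U j \<noteq> {}" using Suc.prems(2,3) by blast
  then have "\<exists>p\<in>U j. \<forall>x\<in>(\<Pi>\<^sub>E i\<in>{..<m} - {j}. U i). x(j := p) \<in> S"
    using ex by (rule ample_on_common_point[OF Suc.prems(1,2)])
  then obtain c where c: "c \<in> ?A U" by blast
  show ?case
  \<comment> \<open>For \<open>k = 0\<close> the factor may be just \<open>{c}\<close>, and then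
    \<open>c\<close> cannot be deleted. For larger \<open>k\<close> every fibre keeps a point, so
    \<open>V j\<close> is nonempty.\<close>
  proof (cases "k = 0")
    case True
    have "card {c} \<le> card (?A U)" using c fin by (intro card_mono) auto
    then show ?thesis using True by (simp del: fun_upd_apply)
  next
    case False
    define V where "V = U(j := U j - {c})"
    have box: "(\<Pi>\<^sub>E i\<in>{..<m} - {j}. V i) = (\<Pi>\<^sub>E i\<in>{..<m} - {j}. U i)"
      by (rule PiE_cong) (simp add: V_def)
    have fibre: "k \<le> card {p\<in>V j. x(j := p) \<in> S}" if "x \<in> (\<Pi>\<^sub>E i\<in>{..<m} - {j}. V i)" for x
    proof -
      have "{p\<in>V j. x(j := p) \<in> S} = {p\<in>U j. x(j := p) \<in> S} - {c}"
        by (auto simp: V_def)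
      moreover have "c \<in> {p\<in>U j. x(j := p) \<in> S}" using c that box by blast
      ultimately show ?thesis using Suc.prems(4)[of x] that box fin
        by (simp del: fun_upd_apply)
    qed
    have "(\<Pi>\<^sub>E i\<in>{..<m} - {j}. V i) \<noteq> {}"
      using Suc.prems(3) unfolding box by (simp add: PiE_eq_empty_iff)
    then obtain x where "x \<in> (\<Pi>\<^sub>E i\<in>{..<m} - {j}. V i)" by blast
    then have "V j \<noteq> {}" using fibre[of x] False by auto
    then have "ample_on m V S"
      unfolding V_def using Suc.prems(1,2) c by (intro ample_on_remove) auto
    moreover have "finite (V i) \<and> V i \<noteq> {}" if "i < m" for i
      using Suc.prems(3)[OF that] \<open>V j \<noteq> {}\<close> by (auto simp: V_def)
    ultimately have "k \<le> card (?A V)"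
      using fibre Suc.prems(2) by (intro Suc.IH)
    also have "?A V = ?A U - {c}"
      unfolding box by (auto simp: V_def)
    finally have "Suc k \<le> Suc (card (?A U - {c}))" by (rule Suc_le_mono[THEN iffD2])
    also have "\<dots> = card (?A U)"
    proof (rule card_Suc_Diff1)
      show "finite (?A U)" by (rule finite_subset[OF _ fin]) (rule Collect_subset)
    qed (rule c)
    finally show ?thesis .
  qed
qed (rule le0)

subsection \<open>Counting boxes along a coordinate\<close>

text \<open>This is \<open>A\<^sub>S(C) \<inter> P\<close>. The parameter \<open>P\<close> allows
  passing between the whole factor and a single block of its partition.\<close>

definition common_points ::
    "nat \<Rightarrow> nat \<Rightarrow> (nat \<Rightarrow> nat) set \<Rightarrow> (nat \<Rightarrow> nat set) \<Rightarrow> nat set \<Rightarrow> nat set" where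
  "common_points m j S C P = {p\<in>P. \<forall>x\<in>(\<Pi>\<^sub>E i\<in>{..<m} - {j}. C i). x(j := p) \<in> S}"

text \<open>The box is the union of its slices at the values \<open>p\<close> in \<open>D\<close>;
  the equation says that filtering \<open>D\<close> for slices inside \<open>S\<close> loses
  nothing.\<close>

lemma PiE_fun_upd_subset_iff:
  assumes "j < m"
  shows "(\<Pi>\<^sub>E i\<in>{..<m}. (C(j := D)) i) \<subseteq> S \<longleftrightarrow> D = common_points m j S C D"
proof -
  have eq: "insert j ({..<m} - {j}) = {..<m}" using assms by blast
  have "(\<Pi>\<^sub>E i\<in>{..<m}. (C(j := D)) i) =
      (\<lambda>(p, x). x(j := p)) ` (D \<times> (\<Pi>\<^sub>E i\<in>{..<m} - {j}. (C(j := D)) i))"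
    using PiE_insert_eq[of j "{..<m} - {j}" "C(j := D)"] unfolding eq fun_upd_same .
  also have "(\<Pi>\<^sub>E i\<in>{..<m} - {j}. (C(j := D)) i) = (\<Pi>\<^sub>E i\<in>{..<m} - {j}. C i)"
    by (rule PiE_cong) simp
  finally have "(\<Pi>\<^sub>E i\<in>{..<m}. (C(j := D)) i) \<subseteq> S \<longleftrightarrow>
      (\<forall>p\<in>D. \<forall>x\<in>(\<Pi>\<^sub>E i\<in>{..<m} - {j}. C i). x(j := p) \<in> S)"
    by (simp only: image_subset_iff split_paired_Ball_Sigma prod.case)
  then show ?thesis unfolding common_points_def by blast
qed

text \<open>Once the other factors \<open>C\<close> are fixed, a box in \<open>S\<close> is given by
  a nonempty set \<open>D\<close> of common points. Its dimension is \<open>d\<close> exactly when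
  \<open>D\<close> has \<open>d - s + 1\<close> elements; the conditional guards the truncated
  subtraction.\<close>

lemma f_vector_eq_sum_choose:
  assumes "j < m"
  shows "f_vector m n S d =
    (\<Sum>C\<in>(\<Pi>\<^sub>E i\<in>{..<m} - {j}. Pow {..<n i} - {{}}).
      let s = (\<Sum>i\<in>{..<m} - {j}. card (C i) - 1) in
      if s \<le> d then card (common_points m j S C {..<n j}) choose Suc (d - s) else 0)"
proof -
  let ?J = "{..<m} - {j}"
  let ?X = "\<Pi>\<^sub>E i\<in>?J. Pow {..<n i} - {{}}"
  let ?s = "\<lambda>C. \<Sum>i\<in>?J. card (C i) - 1"
  let ?A = "\<lambda>C. common_points m j S C {..<n j}"
  let ?D = "\<lambda>C. {D. D \<subseteq> ?A C \<and> D \<noteq> {} \<and> card D - 1 + ?s C = d}"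
  let ?b = "\<lambda>(C, D). \<Pi>\<^sub>E i\<in>{..<m}. (C(j := D)) i"
  have finA: "finite (?A C)" for C by (simp add: common_points_def)
  have finX: "finite ?X" by (intro finite_PiE) auto
  have finD: "finite (?D C)" for C
    by (rule finite_subset[of _ "Pow (?A C)"]) (use finA in auto)
  have dim: "box_dim m (?b (C, D)) = card D - 1 + ?s C" if "C \<in> ?X" "D \<noteq> {}" for C D
  proof -
    have "box_dim m (?b (C, D)) = (\<Sum>i<m. card ((C(j := D)) i) - 1)"
      unfolding prod.case by (rule box_dim_PiE) (use that in \<open>auto simp: PiE_iff\<close>)
    also have "\<dots> = card D - 1 + (\<Sum>i\<in>?J. card ((C(j := D)) i) - 1)"
      using assms by (subst sum.remove[of _ j]) auto
    finally show ?thesis by simp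
  qed
  have sub: "?b (C, D) \<subseteq> S \<and> D \<subseteq> {..<n j} \<longleftrightarrow> D \<subseteq> ?A C" for C D
    unfolding prod.case PiE_fun_upd_subset_iff[OF assms] by (auto simp: common_points_def)
  have "bij_betw ?b (Sigma ?X ?D) {B. is_box m n B \<and> B \<subseteq> S \<and> box_dim m B = d}"
  proof (rule bij_betw_imageI)
    show "inj_on ?b (Sigma ?X ?D)"
    proof (rule inj_onI, clarify)
      fix C D C' D'
      assume C: "C \<in> ?X" and C': "C' \<in> ?X" and D: "D \<noteq> {}" and D': "D' \<noteq> {}"
        and eq: "(\<Pi>\<^sub>E i\<in>{..<m}. (C(j := D)) i) = (\<Pi>\<^sub>E i\<in>{..<m}. (C'(j := D')) i)"
      \<comment> \<open>A product determines its factors once all of them are nonempty.\<close>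
      have ne: "(C(j := D)) i \<noteq> {}" "(C'(j := D')) i \<noteq> {}" if "i \<in> {..<m}" for i
        using C C' D D' that by (auto simp: PiE_iff)
      have "\<forall>i\<in>{..<m}. (C(j := D)) i = (C'(j := D')) i"
        by (rule iffD1[OF PiE_eq_iff_not_empty[of "{..<m}" "C(j := D)" "C'(j := D')", OF ne] eq])
      then have i: "(C(j := D)) i = (C'(j := D')) i" if "i < m" for i
        using that by blast
      have "D = D'" using i[OF assms] by simp
      moreover have "C = C'"
      proof (rule PiE_ext[OF C C'])
        fix i assume "i \<in> ?J" then show "C i = C' i" using i[of i] by simp
      qed
      ultimately show "C = C' \<and> D = D'" by simp
    qed
    show "?b ` Sigma ?X ?D = {B. is_box m n B \<and> B \<subseteq> S \<and> box_dim m B = d}"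
    proof (intro equalityI subsetI)
      fix B assume "B \<in> ?b ` Sigma ?X ?D"
      then obtain C D where C: "C \<in> ?X" and D: "D \<in> ?D C" and B: "B = ?b (C, D)"
        by (elim imageE SigmaE) simp
      have "D \<subseteq> {..<n j}" "B \<subseteq> S" using sub[of C D] D B by blast+
      moreover have "is_box m n B"
        unfolding is_box_def B prod.case
        by (rule exI[of _ "C(j := D)"]) (use C D \<open>D \<subseteq> {..<n j}\<close> in \<open>auto simp: PiE_iff\<close>)
      ultimately show "B \<in> {B. is_box m n B \<and> B \<subseteq> S \<and> box_dim m B = d}"
        using dim[OF C, of D] D B by auto
    next
      fix B assume "B \<in> {B. is_box m n B \<and> B \<subseteq> S \<and> box_dim m B = d}"
      then obtain F where F: "\<And>i. i < m \<Longrightarrow> F i \<noteq> {} \<and> F i \<subseteq> {..<n i}"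
          and B: "B = (\<Pi>\<^sub>E i\<in>{..<m}. F i)" "B \<subseteq> S" "box_dim m B = d"
        unfolding is_box_def by blast
      have X: "restrict F ?J \<in> ?X" using F by auto
      have b: "B = ?b (restrict F ?J, F j)"
        unfolding B(1) prod.case by (rule PiE_cong) simp
      have "F j \<in> ?D (restrict F ?J)"
        using sub[of "restrict F ?J" "F j"] dim[OF X, of "F j"] F[OF assms] b B(2,3) by simp
      then show "B \<in> ?b ` Sigma ?X ?D" using X b by blast
    qed
  qed
  then have 1: "f_vector m n S d = card (Sigma ?X ?D)"
    unfolding f_vector_def by (rule bij_betw_same_card[symmetric])
  have "card (Sigma ?X ?D) = (\<Sum>C\<in>?X. card (?D C))"
    using finX finD by simp
  moreover have "card (?D C) = (if ?s C \<le> d then card (?A C) choose Suc (d - ?s C) else 0)" for C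
  proof (cases "?s C \<le> d")
    case True
    have "card D - 1 + ?s C = d \<longleftrightarrow> card D = Suc (d - ?s C)" if "D \<subseteq> ?A C" "D \<noteq> {}" for D
    proof -
      \<comment> \<open>Nonemptiness of \<open>D\<close> makes the subtraction in
        \<open>card D - 1\<close> exact.\<close>
      have "0 < card D" using that finA by (meson card_gt_0_iff finite_subset)
      then show ?thesis using True by linarith
    qed
    then have "?D C = {D. D \<subseteq> ?A C \<and> card D = Suc (d - ?s C)}"
      using True by auto
    then show ?thesis using True finA by (simp add: n_subsets)
  qed (simp add: not_le)
  ultimately show ?thesis unfolding 1 by (simp only: Let_def)
qed

subsection \<open>Push downs\<close>

lemma one_dimensionalD:
  assumes "one_dimensional m n \<alpha> j"
  shows "j < m" and "partition_on {..<n j} (\<alpha> j)"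
  using assms unfolding one_dimensional_def generalized_partition_def by blast+

lemma one_dimensional_singleton:
  assumes "one_dimensional m n \<alpha> j" and "i < m" and "i \<noteq> j" and "a < n i"
  shows "{a} \<in> \<alpha> i" and "P \<in> \<alpha> i \<Longrightarrow> a \<in> P \<Longrightarrow> P = {a}"
proof -
  have part: "partition_on {..<n i} (\<alpha> i)" and single: "\<And>P. P \<in> \<alpha> i \<Longrightarrow> is_singleton P"
    using assms by (auto simp: one_dimensional_def generalized_partition_def)
  show *: "P = {a}" if "P \<in> \<alpha> i" "a \<in> P" for P
    using single[OF that(1)] that(2) by (auto elim: is_singletonE)
  have "a \<in> \<Union>(\<alpha> i)" using part \<open>a < n i\<close> by (simp add: partition_on_def)
  then show "{a} \<in> \<alpha> i" using * by blast
qed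

text \<open>Exactly one box of the partition contains \<open>x\<close>, and its points are told
  apart by their \<open>j\<close>-th coordinates. Membership therefore compares the rank of
  \<open>x j\<close> in \<open>P\<close> with the number of points of \<open>S\<close> in that
  box.\<close>

lemma mem_push_down_iff:
  assumes od: "one_dimensional m n \<alpha> j" and x: "x \<in> grid m n" and P: "P \<in> \<alpha> j" "x j \<in> P"
  shows "x \<in> push_down m \<alpha> j S \<longleftrightarrow> card {q\<in>P. q < x j} < card {q\<in>P. x(j := q) \<in> S}"
proof -
  have "j < m" and part: "partition_on {..<n j} (\<alpha> j)"
    using one_dimensionalD[OF od] .
  have xi: "x i < n i" if "i < m" for i using x that by (auto simp: grid_def)
  define B where "B = (\<lambda>q. x(j := q)) ` P"
  \<comment> \<open>All blocks outside coordinate \<open>j\<close> are singletons, so the box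
    through \<open>x\<close> is a line in direction \<open>j\<close>.\<close>
  have line: "(\<Pi>\<^sub>E i\<in>{..<m}. if i = j then P else {x i}) = B" (is "?L = B")
  proof (intro equalityI subsetI)
    fix y assume y: "y \<in> ?L"
    have "y i = (x(j := y j)) i" for i
    proof (cases "i < m \<and> i \<noteq> j")
      case True
      then show ?thesis using PiE_mem[OF y, of i] by simp
    next
      case False
      then show ?thesis using PiE_arb[OF y, of i] x by (auto simp: grid_def PiE_iff extensional_def)
    qed
    moreover have "y j \<in> P" using PiE_mem[OF y, of j] \<open>j < m\<close> by simp
    ultimately show "y \<in> B" unfolding B_def by blast
  next
    fix y assume "y \<in> B"
    then show "y \<in> ?L"
      using x \<open>j < m\<close> by (auto simp: B_def grid_def PiE_iff extensional_def)
  qed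
  have mem: "B \<in> box_partition m \<alpha>"
  proof -
    have "\<forall>i<m. (if i = j then P else {x i}) \<in> \<alpha> i"
      using P xi one_dimensional_singleton(1)[OF od] by simp
    then show ?thesis unfolding mem_box_partition_iff line[symmetric]
      by (intro exI[of _ "\<lambda>i. if i = j then P else {x i}"] conjI refl)
  qed
  have unique: "B' = B" if mem': "B' \<in> box_partition m \<alpha>" and "x \<in> B'" for B'
  proof -
    obtain Q where Q: "\<forall>i<m. Q i \<in> \<alpha> i" and B': "B' = (\<Pi>\<^sub>E i\<in>{..<m}. Q i)"
      using mem' unfolding mem_box_partition_iff by (elim exE conjE)
    have xQ: "x i \<in> Q i" if "i < m" for i
      using \<open>x \<in> B'\<close> that by (auto simp: B')
    have "Q j = P"
      using part Q[rule_format, OF \<open>j < m\<close>] xQ[OF \<open>j < m\<close>] P by (auto simp: partition_on_def disjoint_def)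
    moreover have "Q i = {x i}" if "i < m" "i \<noteq> j" for i
      using one_dimensional_singleton(2)[OF od that xi] that Q xQ by blast
    ultimately show ?thesis
      unfolding B' line[symmetric] by (intro PiE_cong) auto
  qed
  have "x \<in> B"
    unfolding B_def using P(2) by (metis fun_upd_triv imageI)
  have inj: "inj_on (\<lambda>q. x(j := q)) A" for A
    by (rule inj_onI) (metis fun_upd_same)
  have "x \<in> push_down m \<alpha> j S \<longleftrightarrow> x \<in> lowest j (card (S \<inter> B)) B"
    using mem unique unfolding push_down_def lowest_def by blast
  also have "\<dots> \<longleftrightarrow> card {y \<in> B. y j < x j} < card (S \<inter> B)"
    using \<open>x \<in> B\<close> by (simp add: lowest_def)
  also have "{y \<in> B. y j < x j} = (\<lambda>q. x(j := q)) ` {q\<in>P. q < x j}"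
    by (auto simp: B_def)
  also have "S \<inter> B = (\<lambda>q. x(j := q)) ` {q\<in>P. x(j := q) \<in> S}"
    by (auto simp: B_def)
  finally show ?thesis by (simp only: card_image[OF inj])
qed

lemma push_down_subset_grid:
  assumes "generalized_partition m n \<alpha>"
  shows "push_down m \<alpha> j S \<subseteq> grid m n"
proof
  fix x assume "x \<in> push_down m \<alpha> j S"
  then obtain B where "B \<in> box_partition m \<alpha>" and x: "x \<in> B"
    unfolding push_down_def lowest_def by blast
  then obtain Q where Q: "\<forall>i<m. Q i \<in> \<alpha> i" and B: "B = (\<Pi>\<^sub>E i\<in>{..<m}. Q i)"
    unfolding mem_box_partition_iff by (elim exE conjE)
  have "Q i \<subseteq> {..<n i}" if "i < m" for i
    using assms Q that unfolding generalized_partition_def partition_on_def by blast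
  then have "B \<subseteq> grid m n" unfolding B grid_def by (intro PiE_mono) simp
  then show "x \<in> grid m n" using x by blast
qed

section \<open>Common points after a push down\<close>

text \<open>The rank is strictly increasing on \<open>P\<close>, hence a bijection onto
  \<open>{..<card P}\<close>; the elements of rank below \<open>k\<close> correspond to
  \<open>{..<k}\<close>.\<close>

lemma card_rank_less:
  fixes P :: "nat set"
  assumes "finite P" and "k \<le> card P"
  shows "card {p\<in>P. card {q\<in>P. q < p} < k} = k"
proof -
  let ?r = "\<lambda>p. card {q\<in>P. q < p}"
  have less: "?r p < ?r p'" if "p \<in> P" "p < p'" for p p'
    using that assms(1) by (intro psubset_card_mono) auto
  have inj: "inj_on ?r P"
  proof (rule inj_onI)
    fix p p' assume "p \<in> P" "p' \<in> P" "?r p = ?r p'"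
    then show "p = p'"
      using less[of p p'] less[of p' p] by (cases rule: linorder_cases[of p p']) auto
  qed
  have "?r ` P \<subseteq> {..<card P}"
    using assms(1) by (auto intro!: psubset_card_mono)
  then have img: "?r ` P = {..<card P}"
    using inj by (intro card_subset_eq) (auto simp: card_image)
  have eq: "{..<k} = ?r ` {p\<in>P. ?r p < k}"
  proof (intro equalityI subsetI)
    fix a assume "a \<in> {..<k}"
    then have "a \<in> ?r ` P" using img assms(2) by auto
    then show "a \<in> ?r ` {p\<in>P. ?r p < k}" using \<open>a \<in> {..<k}\<close> by blast
  qed auto
  have "inj_on ?r {p\<in>P. ?r p < k}"
    by (rule inj_on_subset[OF inj]) (rule Collect_subset)
  then have "card (?r ` {p\<in>P. ?r p < k}) = card {p\<in>P. ?r p < k}"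
    by (rule card_image)
  then show ?thesis unfolding eq[symmetric] card_lessThan by (rule sym)
qed

text \<open>After the push down, \<open>p\<close> is common to all fibres iff its rank in
  \<open>P\<close> is below every fibre size, that is, below their minimum.\<close>

lemma card_common_points_push_down:
  assumes od: "one_dimensional m n \<alpha> j" and P: "P \<in> \<alpha> j"
    and C: "C \<in> (\<Pi>\<^sub>E i\<in>{..<m} - {j}. Pow {..<n i} - {{}})"
  shows "card (common_points m j (push_down m \<alpha> j S) C P) =
    Min ((\<lambda>x. card {q\<in>P. x(j := q) \<in> S}) ` (\<Pi>\<^sub>E i\<in>{..<m} - {j}. C i))"
    (is "_ = Min (?g ` ?X)")
proof -
  have "j < m" and part: "partition_on {..<n j} (\<alpha> j)"
    using one_dimensionalD[OF od] .
  have PU: "P \<subseteq> {..<n j}" using part P by (auto simp: partition_on_def)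
  then have finP: "finite P" using finite_subset by blast
  have finX: "finite ?X"
    using C by (intro finite_PiE) (auto simp: PiE_iff intro: finite_subset)
  have neX: "?X \<noteq> {}" using C by (auto simp: PiE_eq_empty_iff)
  have upd: "x(j := p) \<in> grid m n" if "x \<in> ?X" "p \<in> P" for x p
  proof -
    have "x i < n i" if "i < m" "i \<noteq> j" for i
      using \<open>x \<in> ?X\<close> C that by (auto simp: PiE_iff)
    then show ?thesis
      using that PU \<open>j < m\<close> by (auto simp: grid_def PiE_iff extensional_def)
  qed
  have mem: "x(j := p) \<in> push_down m \<alpha> j S \<longleftrightarrow> card {q\<in>P. q < p} < ?g x"
    if "x \<in> ?X" "p \<in> P" for x p
    using mem_push_down_iff[OF od upd[OF that] P] that(2) by simp
  have "common_points m j (push_down m \<alpha> j S) C P = {p\<in>P. card {q\<in>P. q < p} < Min (?g ` ?X)}"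
    unfolding common_points_def using mem finX neX by auto
  moreover have "Min (?g ` ?X) \<le> card P"
  proof -
    obtain x where "x \<in> ?X" using neX by blast
    then have "Min (?g ` ?X) \<le> ?g x" using finX by simp
    also have "\<dots> \<le> card P" using finP by (intro card_mono) auto
    finally show ?thesis .
  qed
  ultimately show ?thesis using card_rank_less[OF finP] by simp
qed

text \<open>The common points in \<open>P\<close> form a subset of each fibre.\<close>

lemma card_common_points_le_Min:
  assumes "finite P" and "finite (\<Pi>\<^sub>E i\<in>{..<m} - {j}. C i)" and "(\<Pi>\<^sub>E i\<in>{..<m} - {j}. C i) \<noteq> {}"
  shows "card (common_points m j S C P) \<le>
    Min ((\<lambda>x. card {q\<in>P. x(j := q) \<in> S}) ` (\<Pi>\<^sub>E i\<in>{..<m} - {j}. C i))"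
proof (rule Min.boundedI)
  fix a assume "a \<in> (\<lambda>x. card {q\<in>P. x(j := q) \<in> S}) ` (\<Pi>\<^sub>E i\<in>{..<m} - {j}. C i)"
  then obtain x where x: "x \<in> (\<Pi>\<^sub>E i\<in>{..<m} - {j}. C i)" and a: "a = card {q\<in>P. x(j := q) \<in> S}"
    by (elim imageE)
  show "card (common_points m j S C P) \<le> a"
    unfolding a common_points_def by (rule card_mono) (use x assms(1) in auto)
qed (use assms in auto)

text \<open>Reduces the comparison to single blocks, on which the push down acts separately.\<close>

lemma card_common_points_eq_sum:
  assumes "one_dimensional m n \<alpha> j"
  shows "card (common_points m j S C {..<n j}) = (\<Sum>P\<in>\<alpha> j. card (common_points m j S C P))"
proof -
  have part: "partition_on {..<n j} (\<alpha> j)"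
    using assms by (auto simp: one_dimensional_def generalized_partition_def)
  have fin: "finite P" if "P \<in> \<alpha> j" for P
    using part that by (auto simp: partition_on_def intro: finite_subset[of _ "{..<n j}"])
  have "common_points m j S C {..<n j} = (\<Union>P\<in>\<alpha> j. common_points m j S C P)"
    unfolding partition_onD1[OF part] common_points_def by blast
  also have "card \<dots> = (\<Sum>P\<in>\<alpha> j. card (common_points m j S C P))"
  proof (rule card_UN_disjoint)
    show "finite (\<alpha> j)" using finite_elements[OF _ part] by simp
    show "\<forall>P\<in>\<alpha> j. finite (common_points m j S C P)"
      using fin by (simp add: common_points_def)
    show "\<forall>P\<in>\<alpha> j. \<forall>Q\<in>\<alpha> j. P \<noteq> Q \<longrightarrow> common_points m j S C P \<inter> common_points m j S C Q = {}"
    proof (intro ballI impI)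
      fix P Q assume "P \<in> \<alpha> j" "Q \<in> \<alpha> j" "P \<noteq> Q"
      then have "P \<inter> Q = {}" using part by (simp add: partition_on_def disjoint_def)
      then show "common_points m j S C P \<inter> common_points m j S C Q = {}"
        unfolding common_points_def by blast
    qed
  qed
  finally show ?thesis .
qed

lemma card_common_points_le_push_down:
  assumes od: "one_dimensional m n \<alpha> j"
    and C: "C \<in> (\<Pi>\<^sub>E i\<in>{..<m} - {j}. Pow {..<n i} - {{}})"
  shows "card (common_points m j S C {..<n j}) \<le>
    card (common_points m j (push_down m \<alpha> j S) C {..<n j})"
  unfolding card_common_points_eq_sum[OF od]
proof (rule sum_mono)
  fix P assume P: "P \<in> \<alpha> j"
  then have "P \<subseteq> {..<n j}"
    using od by (auto simp: one_dimensional_def generalized_partition_def partition_on_def)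
  moreover have "finite (\<Pi>\<^sub>E i\<in>{..<m} - {j}. C i)"
    using C by (intro finite_PiE) (auto simp: PiE_iff intro: finite_subset)
  moreover have "(\<Pi>\<^sub>E i\<in>{..<m} - {j}. C i) \<noteq> {}" using C by (auto simp: PiE_eq_empty_iff)
  ultimately show
    "card (common_points m j S C P) \<le> card (common_points m j (push_down m \<alpha> j S) C P)"
    unfolding card_common_points_push_down[OF od P C]
    by (intro card_common_points_le_Min) (auto intro: finite_subset)
qed

text \<open>Ampleness passes to the box with factors \<open>C\<close> and \<open>P\<close>. The
  minimal fibre size bounds all fibres there from below, so \<open>ample_on_card_common\<close>
  yields that many common points.\<close>

lemma card_common_points_push_down_le:
  assumes od: "one_dimensional m n \<alpha> j"
    and C: "C \<in> (\<Pi>\<^sub>E i\<in>{..<m} - {j}. Pow {..<n i} - {{}})"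
    and ample: "ample m n S"
  shows "card (common_points m j (push_down m \<alpha> j S) C {..<n j}) \<le>
    card (common_points m j S C {..<n j})"
  unfolding card_common_points_eq_sum[OF od]
proof (rule sum_mono)
  fix P assume P: "P \<in> \<alpha> j"
  let ?X = "\<Pi>\<^sub>E i\<in>{..<m} - {j}. C i" and ?C = "C(j := P)"
  have "j < m" and "partition_on {..<n j} (\<alpha> j)"
    using one_dimensionalD[OF od] .
  then have "P \<subseteq> {..<n j}" "P \<noteq> {}" using P by (auto simp: partition_on_def)
  then have CU: "?C i \<noteq> {} \<and> ?C i \<subseteq> {..<n i}" if "i < m" for i
    using C that by (auto simp: PiE_iff)
  have fin: "finite ?X"
    using C by (intro finite_PiE) (auto simp: PiE_iff intro: finite_subset)
  have box: "(\<Pi>\<^sub>E i\<in>{..<m} - {j}. ?C i) = ?X" by (rule PiE_cong) simp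
  have ample': "ample_on m ?C S"
  proof (rule ample_on_subset)
    show "ample_on m (\<lambda>i. {..<n i}) S" using ample by (simp only: ample_eq_ample_on)
    show "?C i \<noteq> {} \<and> ?C i \<subseteq> {..<n i}" if "i < m" for i using that by (rule CU)
  qed simp
  have "Min ((\<lambda>x. card {q\<in>P. x(j := q) \<in> S}) ` ?X) \<le>
      card {p\<in>?C j. \<forall>x\<in>(\<Pi>\<^sub>E i\<in>{..<m} - {j}. ?C i). x(j := p) \<in> S}"
  proof (rule ample_on_card_common[OF ample' \<open>j < m\<close>])
    show "finite (?C i) \<and> ?C i \<noteq> {}" if "i < m" for i
      using CU[OF that] finite_subset by blast
    show "Min ((\<lambda>x. card {q\<in>P. x(j := q) \<in> S}) ` ?X) \<le> card {p\<in>?C j. x(j := p) \<in> S}"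
      if "x \<in> (\<Pi>\<^sub>E i\<in>{..<m} - {j}. ?C i)" for x
      using that fin unfolding box fun_upd_same by (intro Min_le) auto
  qed
  then show "card (common_points m j (push_down m \<alpha> j S) C P) \<le> card (common_points m j S C P)"
    unfolding card_common_points_push_down[OF od P C] box by (simp add: common_points_def)
qed

section \<open>Comparison of the f-vectors\<close>

text \<open>The counting formula is compared term by term: each binomial coefficient grows with its
  upper argument.\<close>

lemma f_vector_le_push_down:
  assumes od: "one_dimensional m n \<alpha> j"
  shows "f_vector m n S d \<le> f_vector m n (push_down m \<alpha> j S) d"
proof -
  have "j < m" using od by (rule one_dimensionalD)
  show ?thesis
    unfolding f_vector_eq_sum_choose[OF \<open>j < m\<close>]
  proof (rule sum_mono)
    fix C assume "C \<in> (\<Pi>\<^sub>E i\<in>{..<m} - {j}. Pow {..<n i} - {{}})"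
    note le = card_common_points_le_push_down[OF od this, of S]
    show "(let s = \<Sum>i\<in>{..<m} - {j}. card (C i) - 1 in
        if s \<le> d then card (common_points m j S C {..<n j}) choose Suc (d - s) else 0) \<le>
      (let s = \<Sum>i\<in>{..<m} - {j}. card (C i) - 1 in
        if s \<le> d then card (common_points m j (push_down m \<alpha> j S) C {..<n j}) choose Suc (d - s)
        else 0)"
      unfolding Let_def using binomial_right_mono[OF le] by simp
  qed
qed

lemma f_vector_push_down_eq:
  assumes od: "one_dimensional m n \<alpha> j" and ample: "ample m n S"
  shows "f_vector m n (push_down m \<alpha> j S) = f_vector m n S"
proof
  fix d
  have "j < m" using od by (rule one_dimensionalD)
  have "card (common_points m j (push_down m \<alpha> j S) C {..<n j}) =
      card (common_points m j S C {..<n j})"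
    if "C \<in> (\<Pi>\<^sub>E i\<in>{..<m} - {j}. Pow {..<n i} - {{}})" for C
    using card_common_points_le_push_down[OF od that, of S]
      card_common_points_push_down_le[OF od that ample] by simp
  then show "f_vector m n (push_down m \<alpha> j S) d = f_vector m n S d"
    unfolding f_vector_eq_sum_choose[OF \<open>j < m\<close>] by (intro sum.cong refl) (simp only:)
qed

subsection \<open>Complete serial push downs\<close>

text \<open>Closure is stated per coordinate because a serial push down creates it one coordinate at
  a time.\<close>

definition down_closed_at :: "nat \<Rightarrow> (nat \<Rightarrow> nat) set \<Rightarrow> bool" where
  "down_closed_at i T \<longleftrightarrow> (\<forall>x\<in>T. \<forall>p<x i. x(i := p) \<in> T)"

lemma grid_fun_upd: "x \<in> grid m n \<Longrightarrow> j < m \<Longrightarrow> p < n j \<Longrightarrow> x(j := p) \<in> grid m n"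
  by (auto simp: grid_def PiE_iff extensional_def)

text \<open>With the single block \<open>{..<n j}\<close> the rank of \<open>x j\<close> is
  \<open>x j\<close> itself. The formula also covers a factor of size 1, where the coordinate
  partition is not one-dimensional and the push down is the identity.\<close>

lemma push_down_coord_eq:
  assumes S: "S \<subseteq> grid m n" and j: "j < m" "0 < n j"
  shows "push_down_coord m n j S = {x\<in>grid m n. x j < card {q. q < n j \<and> x(j := q) \<in> S}}"
proof (cases "n j = 1")
  case True
  have "x \<in> S \<longleftrightarrow> x j < card {q. q < n j \<and> x(j := q) \<in> S}" if "x \<in> grid m n" for x
  proof -
    have "x j < n j" using that j by (auto simp: grid_def PiE_iff)
    then have "x j = 0" using True by simp
    then have "x(j := 0) = x" by (metis fun_upd_triv)
    then have "{q. q < n j \<and> x(j := q) \<in> S} = (if x \<in> S then {0} else {})"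
      using True by auto
    then show ?thesis using \<open>x j = 0\<close> by simp
  qed
  then show ?thesis using S True by (auto simp: push_down_coord_def)
next
  case False
  let ?\<alpha> = "coord_partition n j"
  have "\<not> is_singleton {..<n j}"
    using False by (simp add: is_singleton_altdef)
  then have od: "one_dimensional m n ?\<alpha> j"
    using j by (auto simp: one_dimensional_def generalized_partition_def coord_partition_def
        partition_on_singletons is_singleton_def intro!: partition_on_space)
  have "push_down m ?\<alpha> j S \<subseteq> grid m n"
    using od unfolding one_dimensional_def by (intro push_down_subset_grid) blast
  moreover have "x \<in> push_down m ?\<alpha> j S \<longleftrightarrow> x j < card {q. q < n j \<and> x(j := q) \<in> S}"
    if x: "x \<in> grid m n" for x
  proof -
    have xj: "x j < n j" using x j by (auto simp: grid_def PiE_iff)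
    have "{q \<in> {..<n j}. q < x j} = {..<x j}" using xj by auto
    then show ?thesis
      using mem_push_down_iff[OF od x, of "{..<n j}"] xj by (simp add: coord_partition_def)
  qed
  ultimately show ?thesis using False by (auto simp: push_down_coord_def)
qed

text \<open>For \<open>i = j\<close> the fibre through the lowered point is unchanged. Otherwise
  lowering coordinate \<open>i\<close> can only enlarge the fibre in direction \<open>j\<close>, so
  the threshold does not drop.\<close>

lemma down_closed_at_push_down_coord:
  assumes S: "S \<subseteq> grid m n" and j: "j < m" "0 < n j" and i: "i = j \<or> down_closed_at i S" "i < m"
  shows "down_closed_at i (push_down_coord m n j S)"
  unfolding down_closed_at_def push_down_coord_eq[OF S j]
proof (intro ballI allI impI)
  fix x p assume x: "x \<in> {x\<in>grid m n. x j < card {q. q < n j \<and> x(j := q) \<in> S}}" and p: "p < x i"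
  have "x i < n i" using x \<open>i < m\<close> by (auto simp: grid_def PiE_iff)
  then have g: "x(i := p) \<in> grid m n" using x p \<open>i < m\<close> by (intro grid_fun_upd) auto
  show "x(i := p) \<in> {x\<in>grid m n. x j < card {q. q < n j \<and> x(j := q) \<in> S}}"
  proof (cases "i = j")
    case True
    then show ?thesis using x p g by simp
  next
    case False
    have "(x(i := p))(j := q) \<in> S" if "x(j := q) \<in> S" for q
    proof -
      have "(x(j := q))(i := p) \<in> S" using i(1) False that p by (simp add: down_closed_at_def)
      then show ?thesis using False by (simp add: fun_upd_twist)
    qed
    then have "card {q. q < n j \<and> x(j := q) \<in> S} \<le> card {q. q < n j \<and> (x(i := p))(j := q) \<in> S}"
      by (intro card_mono) auto
    then show ?thesis using x g False by simp
  qed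
qed

text \<open>A line that meets \<open>S\<close> keeps its lowest point
  \<open>x(j := 0)\<close>.\<close>

lemma push_down_coord_nonempty:
  assumes S: "S \<subseteq> grid m n" "S \<noteq> {}" and j: "j < m" "0 < n j"
  shows "push_down_coord m n j S \<noteq> {}"
proof -
  obtain x where x: "x \<in> S" using S(2) by blast
  have "x j < n j" using x S(1) j by (auto simp: grid_def PiE_iff)
  then have "x j \<in> {q. q < n j \<and> x(j := q) \<in> S}" using x by simp
  then have "0 < card {q. q < n j \<and> x(j := q) \<in> S}" by (subst card_gt_0_iff) auto
  moreover have "x(j := 0) \<in> grid m n" using x S(1) j by (intro grid_fun_upd) auto
  ultimately have "x(j := 0) \<in> push_down_coord m n j S"
    unfolding push_down_coord_eq[OF S(1) j] by simp
  then show ?thesis by blast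
qed

text \<open>Each coordinate becomes closed when it is processed and stays so afterwards; the
  disjunction carries both facts through the induction.\<close>

lemma serial_push_down_properties:
  assumes "\<forall>i<m. 0 < n i" and "S \<subseteq> grid m n" and "S \<noteq> {}" and "set js \<subseteq> {..<m}"
  shows "serial_push_down m n js S \<subseteq> grid m n \<and> serial_push_down m n js S \<noteq> {} \<and>
    (\<forall>i<m. i \<in> set js \<or> down_closed_at i S \<longrightarrow> down_closed_at i (serial_push_down m n js S))"
  using assms(2-4)
proof (induction js arbitrary: S)
  case Nil
  then show ?case by (simp add: serial_push_down_def)
next
  case (Cons j js)
  have j: "j < m" "0 < n j" using Cons.prems(3) assms(1) by auto
  let ?T = "push_down_coord m n j S"
  have "?T \<subseteq> grid m n" using push_down_coord_eq[OF Cons.prems(1) j] by blast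
  moreover have "?T \<noteq> {}" using push_down_coord_nonempty Cons.prems j by blast
  moreover have "down_closed_at i ?T" if "i < m" "i = j \<or> down_closed_at i S" for i
    using down_closed_at_push_down_coord[OF Cons.prems(1) j that(2,1)] .
  moreover have "serial_push_down m n (j # js) S = serial_push_down m n js ?T"
    by (simp add: serial_push_down_def)
  ultimately show ?case using Cons.IH[of ?T] Cons.prems(3) by auto
qed

section \<open>Down-sets as bouquets of prisms\<close>

lemma down_closedD:
  assumes down: "\<forall>i<m. down_closed_at i T" and "T \<subseteq> grid m n"
    and x: "x \<in> T" and y: "y \<in> grid m n" and le: "\<And>i. i < m \<Longrightarrow> y i \<le> x i"
  shows "y \<in> T"
proof -
  \<comment> \<open>The coordinates of \<open>x\<close> are replaced by those of \<open>y\<close>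
    one after another; \<open>down_closed_at\<close> covers strict decreases, so equal coordinates
    are treated apart.\<close>
  have "(\<lambda>i. if i < k then y i else x i) \<in> T" if "k \<le> m" for k
    using that
  proof (induction k)
    case (Suc k)
    let ?z = "\<lambda>i. if i < k then y i else x i"
    have "?z(k := y k) \<in> T"
    proof (cases "y k = x k")
      case True
      then have "?z(k := y k) = ?z" by auto
      then show ?thesis using Suc by simp
    next
      case False
      then have "y k < ?z k" using le[of k] Suc.prems by simp
      then show ?thesis using down Suc unfolding down_closed_at_def by simp
    qed
    moreover have "?z(k := y k) = (\<lambda>i. if i < Suc k then y i else x i)" by auto
    ultimately show ?case by simp
  qed (use x in simp)
  then have "(\<lambda>i. if i < m then y i else x i) \<in> T" by simp
  moreover have "(\<lambda>i. if i < m then y i else x i) = y"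
  proof
    fix i
    have "x \<in> grid m n" using x \<open>T \<subseteq> grid m n\<close> by blast
    then show "(if i < m then y i else x i) = y i"
      using y by (auto simp: grid_def PiE_iff extensional_def)
  qed
  ultimately show ?thesis by simp
qed

text \<open>Adding \<open>0\<close> to every factor of a box in \<open>T\<close> gives a box in
  \<open>T\<close>. A maximal box thus equals its enlargement, which contains the origin.\<close>

lemma down_closed_imp_bouquet:
  assumes pos: "\<forall>i<m. 0 < n i" and T: "T \<subseteq> grid m n" "T \<noteq> {}"
    and down: "\<forall>i<m. down_closed_at i T"
  shows "bouquet_of_prisms m n (origin m) T"
  unfolding bouquet_of_prisms_def
proof (intro conjI allI impI)
  have origin: "origin m \<in> grid m n" using pos by (auto simp: origin_def grid_def)
  obtain x where "x \<in> T" using T(2) by blast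
  then show "origin m \<in> T"
    using down_closedD[OF down T(1) _ origin] by (simp add: origin_def)
  fix B assume B: "maximal_box m n T B"
  then obtain C where C: "\<forall>i<m. C i \<noteq> {} \<and> C i \<subseteq> {..<n i}"
      and BC: "B = (\<Pi>\<^sub>E i\<in>{..<m}. C i)" and BT: "B \<subseteq> T"
    unfolding maximal_box_def is_box_def by blast
  define B' where "B' = (\<Pi>\<^sub>E i\<in>{..<m}. insert 0 (C i))"
  have "is_box m n B'"
    unfolding is_box_def B'_def by (rule exI[of _ "\<lambda>i. insert 0 (C i)"]) (use C pos in auto)
  moreover have "B \<subseteq> B'" unfolding BC B'_def by (rule PiE_mono) blast
  moreover have "B' \<subseteq> T"
  proof
    fix y assume y: "y \<in> B'"
    have "\<exists>c. c \<in> C i" if "i < m" for i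
      using C that by blast
    then obtain c where c: "\<And>i. i < m \<Longrightarrow> c i \<in> C i" by metis
    \<comment> \<open>Entries of \<open>y\<close> outside \<open>C i\<close> must be the added
      \<open>0\<close>; replacing them by elements of \<open>C i\<close> gives a point of
      \<open>B\<close> that dominates \<open>y\<close>.\<close>
    define x where "x = (\<lambda>i\<in>{..<m}. if y i \<in> C i then y i else c i)"
    have "x \<in> B"
      unfolding BC x_def using c by auto
    moreover have "y \<in> grid m n"
    proof -
      have "B' \<subseteq> grid m n"
        unfolding B'_def grid_def by (rule PiE_mono) (use C pos in auto)
      then show ?thesis using y by blast
    qed
    moreover have "y i \<le> x i" if "i < m" for i
    proof -
      have "y i \<in> insert 0 (C i)" using y that unfolding B'_def by (intro PiE_mem[of y]) auto
      then show ?thesis using that by (auto simp: x_def)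
    qed
    ultimately show "y \<in> T" using down_closedD[OF down T(1)] BT by blast
  qed
  ultimately have "B' = B" using B unfolding maximal_box_def by blast
  moreover have "origin m \<in> B'" by (auto simp: B'_def origin_def)
  ultimately show "origin m \<in> B" by simp
qed (use T in blast)

theorem proposition3:
  fixes m :: nat and n :: "nat \<Rightarrow> nat" and S :: "(nat \<Rightarrow> nat) set"
  assumes "\<forall>i<m. 0 < n i"
    and "S \<subseteq> grid m n"
  shows "(\<forall>\<alpha> j. one_dimensional m n \<alpha> j \<longrightarrow>
            (\<forall>i. f_vector m n S i \<le> f_vector m n (push_down m \<alpha> j S) i)) \<and>
         (ample m n S \<longrightarrow>
            (\<forall>\<alpha> j. one_dimensional m n \<alpha> j \<longrightarrow>
               (\<forall>i. f_vector m n S i = f_vector m n (push_down m \<alpha> j S) i) \<and>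
               f_vector m n (push_down m \<alpha> j S) = f_vector m n S) \<and>
            (S \<noteq> {} \<longrightarrow>
               (\<forall>js. distinct js \<and> set js = {..<m} \<longrightarrow>
                  bouquet_of_prisms m n (origin m) (serial_push_down m n js S))))"
proof -
  have "bouquet_of_prisms m n (origin m) (serial_push_down m n js S)"
    if "S \<noteq> {}" "set js = {..<m}" for js
    \<comment> \<open>Since \<open>js\<close> lists every coordinate, the result is closed downwards
      in all of them.\<close>
    using serial_push_down_properties[OF assms that(1), of js] that(2)
    by (intro down_closed_imp_bouquet assms(1)) auto
  then show ?thesis
    using f_vector_le_push_down f_vector_push_down_eq by simp
qed

end
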